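(* Let $P\subset\mathbb{R}^d$ be a full-dimensional convex polytope. Then $P$ has a vertex-facet assignment if and only if $$f_0(\sigma)+f_0(\sigma^* )\le \max\{f_0(P),\,f_0(P^* )\}$$ for every face $\sigma$ of $P$ (including the empty face and $P$ itself).
   Context: A convex polytope $P\subset\mathbb{R}^d$ is the convex hull of finitely many points; it is full-dimensional if its affine hull is $\mathbb{R}^d$. Faces of $P$ include $\emptyset$ and $P$. Notation: $f_0(\sigma)$ is the number of vertices of $P$ contained in the face $\sigma$; $f_0(P)$ is the number of vertices of $P$; $f_0(P^* )$ denotes the number of facets of $P$; $f_0(\sigma^* )$ denotes the number of facets of $P$ that contain the face $\sigma$. A vertex-facet assignment of $P$ is a set $M$ of pairs $(v,F)$ with $v$ a vertex of $P$, $F$ a facet of $P$, and $v\notin F$, such that each vertex and each facet occurs in at most one pair of $M$, and such that either every vertex of $P$ occurs in some pair of $M$ or every facet of $P$ occurs in some pair of $M$ (or both). *)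

theory Defs
  imports "HOL-Analysis.Analysis"
begin

definition polytope_vertices :: "'a::euclidean_space set \<Rightarrow> 'a set" where
  "polytope_vertices P = {v. v extreme_point_of P}"

definition polytope_facets :: "'a::euclidean_space set \<Rightarrow> 'a set set" where
  "polytope_facets P = {F. F facet_of P}"

text \<open>For a face \<open>\<sigma>\<close> of \<open>P\<close>, \<open>num_vertices P \<sigma>\<close> is $f_0(\sigma)$ and
  \<open>num_facets P \<sigma>\<close> is $f_0(\sigma^*)$.\<close>

definition num_vertices :: "'a::euclidean_space set \<Rightarrow> 'a set \<Rightarrow> nat" where
  "num_vertices P \<sigma> = card {v \<in> polytope_vertices P. v \<in> \<sigma>}"

definition num_facets :: "'a::euclidean_space set \<Rightarrow> 'a set \<Rightarrow> nat" where
  "num_facets P \<sigma> = card {F \<in> polytope_facets P. \<sigma> \<subseteq> F}"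

definition vertex_facet_assignment ::
    "'a::euclidean_space set \<Rightarrow> ('a \<times> 'a set) set \<Rightarrow> bool" where
  "vertex_facet_assignment P M \<longleftrightarrow>
     (\<forall>(v, F) \<in> M. v \<in> polytope_vertices P \<and> F \<in> polytope_facets P \<and> v \<notin> F) \<and>
     (\<forall>v F F'. (v, F) \<in> M \<and> (v, F') \<in> M \<longrightarrow> F = F') \<and>
     (\<forall>v v' F. (v, F) \<in> M \<and> (v', F) \<in> M \<longrightarrow> v = v') \<and>
     ((\<forall>v \<in> polytope_vertices P. \<exists>F. (v, F) \<in> M) \<or>
      (\<forall>F \<in> polytope_facets P. \<exists>v. (v, F) \<in> M))"

end

theory Submission
  imports Defs
begin

text \<open>
  A vertex-facet assignment is a matching, saturating the smaller side, in the bipartite graph of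
  non-incident vertices and facets. In Hall's condition for a set \<open>A\<close> of vertices, the facets that
  are not neighbours of \<open>A\<close> are those containing \<open>A\<close>, equivalently those containing the smallest
  face around \<open>A\<close>. Dually, the vertices that are not neighbours of a set of facets are those of the
  intersection of these facets, again a face. So it suffices to verify Hall's condition for faces.
\<close>

text \<open>Strong induction on the index set. If a nonempty proper subset \<open>J\<close> meets
  Hall's condition with equality, \<open>J\<close> is matched by itself and the rest is matched
  outside the values available to \<open>J\<close>. If there is no such \<open>J\<close>, every
  nonempty proper subset has a spare value, so one index can be given any of its values and the rest
  still satisfies the condition.\<close>

theorem hall_marriage:
  fixes A :: "'i \<Rightarrow> 'b set"
  assumes "finite I" "\<And>i. i \<in> I \<Longrightarrow> finite (A i)"
    and "\<And>J. J \<subseteq> I \<Longrightarrow> card J \<le> card (\<Union>(A ` J))"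
  shows "\<exists>f. inj_on f I \<and> (\<forall>i\<in>I. f i \<in> A i)"
  using assms
proof (induction I arbitrary: A rule: finite_psubset_induct)
  case (psubset I)
  note fin = psubset.prems(1) and hall = psubset.prems(2)
  consider "I = {}"
    | (tight) J where "J \<subset> I" "J \<noteq> {}" "card J = card (\<Union>(A ` J))"
    | (loose) "I \<noteq> {}" "\<And>J. J \<subset> I \<Longrightarrow> J \<noteq> {} \<Longrightarrow> card J < card (\<Union>(A ` J))"
  proof (cases "\<exists>J. J \<subset> I \<and> J \<noteq> {} \<and> card J = card (\<Union>(A ` J))")
    case False
    then have "card J < card (\<Union>(A ` J))" if "J \<subset> I" "J \<noteq> {}" for J
      using hall[of J] that by (meson le_neq_implies_less psubset_imp_subset)
    then show ?thesis using that(1,3) by blast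
  qed (use that(2) in blast)
  then show ?case
  proof cases
    case 1
    then show ?thesis by simp
  next
    case tight
    have JI: "J \<subseteq> I" using tight by blast
    have finJ: "finite J" using JI \<open>finite I\<close> finite_subset by blast
    have "\<exists>f. inj_on f J \<and> (\<forall>i\<in>J. f i \<in> A i)"
    proof (rule psubset.IH[OF tight(1)])
      show "finite (A i)" if "i \<in> J" for i using fin that JI by blast
      show "card K \<le> card (\<Union>(A ` K))" if "K \<subseteq> J" for K
        using hall[OF subset_trans[OF that JI]] .
    qed
    then obtain f where f: "inj_on f J" "\<forall>i\<in>J. f i \<in> A i" by blast
    \<comment> \<open>Discarding the values available to \<open>J\<close> keeps \<open>g\<close>
      from colliding with \<open>f\<close>. Hall's condition survives: apply it to
      \<open>J \<union> K\<close> and subtract the equality for \<open>J\<close>.\<close>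
    define B where "B i = A i - \<Union>(A ` J)" for i
    have "card K \<le> card (\<Union>(B ` K))" if K: "K \<subseteq> I - J" for K
    proof -
      have "finite K" using K \<open>finite I\<close> finite_subset by blast
      have finU: "finite (\<Union>(A ` (J \<union> K)))"
        using \<open>finite K\<close> finJ fin JI K by (intro finite_UN_I) auto
      have "card J + card K = card (J \<union> K)"
        using K finJ \<open>finite K\<close> by (subst card_Un_disjoint) auto
      also have "\<dots> \<le> card (\<Union>(A ` (J \<union> K)))"
        using hall JI K by blast
      also have "\<dots> = card (\<Union>(A ` J)) + card (\<Union>(A ` (J \<union> K)) - \<Union>(A ` J))"
      proof -
        have "\<Union>(A ` J) \<subseteq> \<Union>(A ` (J \<union> K))" by blast
        then show ?thesis
          using finU card_mono[OF finU] card_Diff_subset[OF finite_subset[OF _ finU]] by simp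
      qed
      also have "\<Union>(A ` (J \<union> K)) - \<Union>(A ` J) = \<Union>(B ` K)"
        by (auto simp: B_def)
      finally show ?thesis using tight(3) by simp
    qed
    moreover have "I - J \<subset> I" using tight by blast
    ultimately have "\<exists>g. inj_on g (I - J) \<and> (\<forall>i\<in>I - J. g i \<in> B i)"
      using psubset.IH[of "I - J" B] fin by (simp add: B_def)
    then obtain g where g: "inj_on g (I - J)" "\<forall>i\<in>I - J. g i \<in> B i" by blast
    let ?h = "\<lambda>i. if i \<in> J then f i else g i"
    have disj: "f i \<noteq> g j" if "i \<in> J" "j \<in> I - J" for i j
      using f(2) g(2) that by (force simp: B_def)
    have "inj_on ?h I"
    proof (rule inj_onI)
      fix a b assume "a \<in> I" "b \<in> I" "?h a = ?h b"
      then show "a = b"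
        using disj[of a b] disj[of b a] inj_onD[OF f(1), of a b] inj_onD[OF g(1), of a b]
        by (simp split: if_splits)
    qed
    moreover have "\<forall>i\<in>I. ?h i \<in> A i"
      using f(2) g(2) by (auto simp: B_def)
    ultimately show ?thesis by blast
  next
    case loose
    then obtain i where i: "i \<in> I" by blast
    have "card {i} \<le> card (\<Union>(A ` {i}))" using hall i by blast
    then have "A i \<noteq> {}" by auto
    then obtain x where x: "x \<in> A i" by blast
    define B where "B j = A j - {x}" for j
    have "card K \<le> card (\<Union>(B ` K))" if K: "K \<subseteq> I - {i}" for K
    proof (cases "K = {}")
      case False
      \<comment> \<open>\<open>K\<close> misses \<open>i\<close>, so it is a proper subset and the
        inequality is strict; this slack pays for the possible loss of \<open>x\<close>.\<close>
      have "card K < card (\<Union>(A ` K))" using loose(2) K i False by blast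
      moreover have "card (\<Union>(A ` K)) - 1 \<le> card (\<Union>(A ` K) - {x})"
        by (simp add: card_Diff_singleton_if)
      moreover have "\<Union>(A ` K) - {x} = \<Union>(B ` K)" by (auto simp: B_def)
      ultimately show ?thesis by simp
    qed simp
    moreover have "I - {i} \<subset> I" using i by blast
    ultimately have "\<exists>g. inj_on g (I - {i}) \<and> (\<forall>j\<in>I - {i}. g j \<in> B j)"
      using psubset.IH[of "I - {i}" B] fin by (simp add: B_def)
    then obtain g where g: "inj_on g (I - {i})" "\<forall>j\<in>I - {i}. g j \<in> B j" by blast
    have "inj_on (g(i := x)) I"
      using g by (auto simp: inj_on_def B_def)
    moreover have "\<forall>j\<in>I. (g(i := x)) j \<in> A j"
      using g(2) x by (auto simp: B_def)
    ultimately show ?thesis by blast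
  qed
qed

lemma finite_polytope_vertices:
  "polytope P \<Longrightarrow> finite (polytope_vertices P)"
  unfolding polytope_vertices_def
  by (simp add: finite_polyhedron_extreme_points polytope_imp_polyhedron)

lemma finite_polytope_facets_set:
  "polytope P \<Longrightarrow> finite (polytope_facets P)"
  unfolding polytope_facets_def by (rule finite_polytope_facets)

text \<open>If the vertices are saturated, those in \<open>\<sigma>\<close> have distinct partners,
  and none of these facets contains \<open>\<sigma>\<close> because each avoids a point of it. If
  the facets are saturated, those containing \<open>\<sigma>\<close> have distinct partners outside
  \<open>\<sigma>\<close>. Either way both counts fit into the side that receives the
  partners.\<close>

lemma assignment_imp_face_count_le:
  assumes "polytope P" and M: "vertex_facet_assignment P M"
  shows "num_vertices P \<sigma> + num_facets P \<sigma>
    \<le> max (card (polytope_vertices P)) (card (polytope_facets P))"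
proof -
  let ?V = "polytope_vertices P" and ?W = "polytope_facets P"
  let ?A = "{v \<in> ?V. v \<in> \<sigma>}" and ?B = "{F \<in> ?W. \<sigma> \<subseteq> F}"
  have finV: "finite ?V" and finW: "finite ?W"
    using assms(1) by (simp_all add: finite_polytope_vertices finite_polytope_facets_set)
  have "\<forall>(v, F)\<in>M. v \<in> ?V \<and> F \<in> ?W \<and> v \<notin> F"
    using M unfolding vertex_facet_assignment_def by (rule conjunct1)
  then have pair: "v \<in> ?V \<and> F \<in> ?W \<and> v \<notin> F" if "(v, F) \<in> M" for v F
    using that by auto
  have fun1: "F = F'" if "(v, F) \<in> M" "(v, F') \<in> M" for v F F'
    using M that unfolding vertex_facet_assignment_def by blast
  have fun2: "v = v'" if "(v, F) \<in> M" "(v', F) \<in> M" for v v' F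
    using M that unfolding vertex_facet_assignment_def by blast
  consider "\<forall>v\<in>?V. \<exists>F. (v, F) \<in> M" | "\<forall>F\<in>?W. \<exists>v. (v, F) \<in> M"
    using M unfolding vertex_facet_assignment_def by blast
  then show ?thesis
  proof cases
    case 1
    then obtain f where f: "\<And>v. v \<in> ?V \<Longrightarrow> (v, f v) \<in> M" by metis
    have "inj_on f ?A" using f fun2 by (intro inj_onI) (metis (mono_tags, lifting) mem_Collect_eq)
    moreover have "f ` ?A \<subseteq> ?W - ?B" using f pair by blast
    ultimately have "card ?A \<le> card (?W - ?B)"
      using finW by (meson card_inj_on_le finite_Diff)
    also have "\<dots> = card ?W - card ?B"
      using finW by (simp add: card_Diff_subset)
    finally have "card ?A \<le> card ?W - card ?B" .
    \<comment> \<open>Subtraction on naturals is truncated, so this bound is needed to turn the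
      difference into a sum.\<close>
    moreover have "card ?B \<le> card ?W" using finW by (simp add: card_mono)
    ultimately show ?thesis unfolding num_vertices_def num_facets_def by linarith
  next
    case 2
    then obtain f where f: "\<And>F. F \<in> ?W \<Longrightarrow> (f F, F) \<in> M" by metis
    have "inj_on f ?B" using f fun1 by (intro inj_onI) (metis (mono_tags, lifting) mem_Collect_eq)
    moreover have "f ` ?B \<subseteq> ?V - ?A" using f pair by blast
    ultimately have "card ?B \<le> card (?V - ?A)"
      using finV by (meson card_inj_on_le finite_Diff)
    also have "\<dots> = card ?V - card ?A"
      using finV by (simp add: card_Diff_subset)
    finally have "card ?B \<le> card ?V - card ?A" .
    moreover have "card ?A \<le> card ?V" using finV by (simp add: card_mono)
    ultimately show ?thesis unfolding num_vertices_def num_facets_def by linarith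
  qed
qed

lemma face_count_le_imp_assignment:
  assumes P: "polytope P"
    and le: "\<And>\<sigma>. \<sigma> face_of P \<Longrightarrow> num_vertices P \<sigma> + num_facets P \<sigma>
      \<le> max (card (polytope_vertices P)) (card (polytope_facets P))"
  shows "\<exists>M. vertex_facet_assignment P M"
proof -
  let ?V = "polytope_vertices P" and ?W = "polytope_facets P"
  have finV: "finite ?V" and finW: "finite ?W"
    using P by (simp_all add: finite_polytope_vertices finite_polytope_facets_set)
  show ?thesis
  \<comment> \<open>The smaller side is the one to saturate; the maximum in \<open>le\<close> is
    then the size of the other side.\<close>
  proof (cases "card ?V \<le> card ?W")
    case True
    define N where "N v = {F \<in> ?W. v \<notin> F}" for v
    have "card A \<le> card (\<Union>(N ` A))" if A: "A \<subseteq> ?V" for A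
    proof -
      \<comment> \<open>The smallest face containing \<open>A\<close>. Facets are themselves faces,
        so a facet contains \<open>A\<close> exactly when it contains
        \<open>\<sigma>\<close>.\<close>
      define \<sigma> where "\<sigma> = \<Inter>{T. T face_of P \<and> A \<subseteq> T}"
      have "A \<subseteq> P" using A by (auto simp: polytope_vertices_def extreme_point_of_def)
      then have "P \<in> {T. T face_of P \<and> A \<subseteq> T}"
        using P by (simp add: face_of_refl polytope_imp_convex)
      then have "\<sigma> face_of P" unfolding \<sigma>_def by (intro face_of_Inter) auto
      have "A \<subseteq> {v \<in> ?V. v \<in> \<sigma>}" using A by (auto simp: \<sigma>_def)
      then have "card A \<le> num_vertices P \<sigma>"
        using finV by (simp add: num_vertices_def card_mono)
      moreover have "\<Union>(N ` A) = ?W - {F \<in> ?W. \<sigma> \<subseteq> F}"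
        using \<open>A \<subseteq> {v \<in> ?V. v \<in> \<sigma>}\<close>
        by (auto simp: N_def \<sigma>_def polytope_facets_def dest: facet_of_imp_face_of)
      then have "card (\<Union>(N ` A)) = card ?W - num_facets P \<sigma>"
        using finW by (simp add: card_Diff_subset num_facets_def)
      ultimately show ?thesis using le[OF \<open>\<sigma> face_of P\<close>] True by simp
    qed
    moreover have "finite (N v)" for v using finW by (simp add: N_def)
    ultimately obtain f where f: "inj_on f ?V" "\<forall>v\<in>?V. f v \<in> N v"
      using hall_marriage[OF finV, of N] by blast
    \<comment> \<open>The graph of \<open>f\<close> gives each vertex only one facet; injectivity
      gives each facet at most one vertex.\<close>
    then have "vertex_facet_assignment P ((\<lambda>v. (v, f v)) ` ?V)"
      unfolding vertex_facet_assignment_def by (auto simp: N_def inj_on_def)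
    then show ?thesis ..
  next
    case False
    define N where "N F = {v \<in> ?V. v \<notin> F}" for F
    have "card B \<le> card (\<Union>(N ` B))" if B: "B \<subseteq> ?W" for B
    \<comment> \<open>The empty family is treated apart because its intersection is
      \<open>UNIV\<close>, which is not a face of \<open>P\<close>.\<close>
    proof (cases "B = {}")
      case nonempty: False
      have "\<Inter>B face_of P"
        using nonempty B
        by (intro face_of_Inter) (auto simp: polytope_facets_def dest: facet_of_imp_face_of)
      \<comment> \<open>Further facets may contain \<open>\<Inter>B\<close>; counting them too only
        strengthens the bound on \<open>card B\<close>.\<close>
      have "B \<subseteq> {F \<in> ?W. \<Inter>B \<subseteq> F}" using B by blast
      then have "card B \<le> num_facets P (\<Inter>B)"
        unfolding num_facets_def using finW by (intro card_mono) auto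
      moreover have "\<Union>(N ` B) = ?V - {v \<in> ?V. v \<in> \<Inter>B}"
        by (auto simp: N_def)
      then have "card (\<Union>(N ` B)) = card ?V - num_vertices P (\<Inter>B)"
        unfolding num_vertices_def using finV by (simp only:) (intro card_Diff_subset; simp)
      ultimately show ?thesis using le[OF \<open>\<Inter>B face_of P\<close>] False by simp
    qed simp
    moreover have "finite (N F)" for F using finV by (simp add: N_def)
    ultimately obtain f where f: "inj_on f ?W" "\<forall>F\<in>?W. f F \<in> N F"
      using hall_marriage[OF finW, of N] by blast
    then have "vertex_facet_assignment P ((\<lambda>F. (f F, F)) ` ?W)"
      unfolding vertex_facet_assignment_def by (auto simp: N_def inj_on_def)
    then show ?thesis ..
  qed
qed

theorem theorem4p3:
  fixes P :: "(real ^ 'd) set"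
  assumes "polytope P"
    and "affine hull P = UNIV"
  shows "(\<exists>M. vertex_facet_assignment P M) \<longleftrightarrow>
    (\<forall>\<sigma>. \<sigma> face_of P \<longrightarrow>
      num_vertices P \<sigma> + num_facets P \<sigma>
        \<le> max (card (polytope_vertices P)) (card (polytope_facets P)))"
  using assignment_imp_face_count_le[OF assms(1)] face_count_le_imp_assignment[OF assms(1)]
  by blast

end
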